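(* Let $d,m$ be integers with $1\leq d\leq m-2$. Cells of $\operatorname{DConf}(\Delta^{m,d},2)$ are in one-to-one correspondence with ordered pairs $(A,B)$ of disjoint nonempty subsets of $\{0,1,\ldots,m\}$ with $|A|\leq d+1$ and $|B|\leq d+1$. The cell corresponding to $(A,B)$ is critical with respect to the gradient field $W(\Delta^{m,d},2)$ if and only if one of the following seven mutually exclusive conditions holds. In dimension $0$: 1. $(A,B)=(\{m-1\},\{m\})$. In dimension $d$: 2. $B=\{b\}$ with $b\geq1$, $b-1\notin A$, $\langle b+1,m\rangle\subseteq A$ and $|A|=d+1$. 3. $A=\{m\}$, $\max B<m-1$ and $|B|=d+1$. 4. $\max B=m-1$, $\langle0,m-1\rangle\neq B$, $A=\{\max(\langle0,m-1\rangle-B)\}$ and $|B|=d+1$. In dimension $2d$: 5. $\max A<m$, $\langle1+\max B,m-1\rangle\not\subseteq A$, $|A|=|B|=d+1$ and $2(d+1)\leq m$. 6. $\max(A\cup B)<m$, $\langle1+\max B,m-1\rangle\subseteq A$, $\langle0,\max B\rangle\neq B$, $\max(\langle0,\max B\rangle-B)\notin A$, $|A|=|B|=d+1$ and $2(d+1)<m$. In dimension $m-2$: 7. $(A,B)=(\langle d+1,m-1\rangle,\langle0,d\rangle)$ and $m\leq2(d+1)$.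
   Context: For integers $p,q$, $\langle p,q\rangle=\{p,p+1,\ldots,q\}$, which is empty if $p>q$. $\Delta^{m,d}$ is the $d$-skeleton of the $m$-simplex with vertex set $\{0,1,\ldots,m\}$ (usual order). $X=\operatorname{DConf}(\Delta^{m,d},2)$ is the subcomplex of the product cell complex $\Delta^{m,d}\times\Delta^{m,d}$ consisting of the products of two simplices with disjoint vertex sets; the cell with vertex sets $(A,B)$ has dimension $|A|+|B|-2$, and faces are given by coordinatewise inclusion. For a cell $\alpha=(A,B)$ and $u\notin A\cup B$, put $\alpha+_1u=(A\cup\{u\},B)$ and $\alpha+_2u=(A,B\cup\{u\})$, whenever the result is a cell of $X$ (i.e. cardinalities stay at most $d+1$). Order on cells: simplices (nonempty vertex sets written as increasing lists) are ordered by dimension first and lexicographically within the same dimension; cells $(A,B)$ are ordered lexicographically over the two coordinates. Construction of the gradient field $W=W(\Delta^{m,d},2)$: initialize $W:=\varnothing$ and, for each $p$, let $A^p$ be the set of all $p$-dimensional cells of $X$. For $p=\dim X-1,\ldots,1,0$ (in that order), provided $A^p$ and $A^{p+1}$ are currently nonempty, do: for $r=2,1$ (in that order); for $u=m,m-1,\ldots,0$ (in that order); for $\alpha$ running through the current $A^p$ in increasing order: if $\alpha+_ru$ is defined and currently $(\alpha,\alpha+_ru)\in A^p\times A^{p+1}$, add the pairing $\alpha\nearrow\alpha+_ru$ to $W$, and remove $\alpha$ from $A^p$ and $\alpha+_ru$ from $A^{p+1}$. A cell is critical if it belongs to no pairing of the final $W$. *)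

theory Defs
  imports Main "HOL-Library.List_Lenlexorder" "HOL-Library.Product_Lexorder"
begin

section \<open>The discretized configuration space\<close>

text \<open>A simplex is represented by its vertex set, and the cell \<open>\<sigma> \<times> \<tau>\<close> of a product of two
  simplicial complexes by the pair of vertex sets.\<close>

type_synonym cell = "nat set \<times> nat set"

definition simplex_dim :: "nat set \<Rightarrow> nat" where
  "simplex_dim S = card S - 1"

definition simplex :: "nat \<Rightarrow> nat set set" where
  "simplex m = {S. S \<noteq> {} \<and> S \<subseteq> {0..m}}"

definition skeleton :: "nat \<Rightarrow> nat set set \<Rightarrow> nat set set" where
  "skeleton d K = {S \<in> K. simplex_dim S \<le> d}"

definition DConf2 :: "nat set set \<Rightarrow> cell set" where
  "DConf2 K = {(A, B) \<in> K \<times> K. A \<inter> B = {}}"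

definition cell_dim :: "cell \<Rightarrow> nat" where
  "cell_dim c = simplex_dim (fst c) + simplex_dim (snd c)"

section \<open>The gradient field\<close>

text \<open>Cells are compared through the increasing lists of their vertices. Lists carry the order of
  \<open>List_Lenlexorder\<close> (length first, then lexicographic) and pairs the lexicographic order.\<close>

definition cell_key :: "cell \<Rightarrow> nat list \<times> nat list" where
  "cell_key c = (sorted_list_of_set (fst c), sorted_list_of_set (snd c))"

definition increasing_cells :: "cell set \<Rightarrow> cell list" where
  "increasing_cells C = sorted_key_list_of_set cell_key C"

text \<open>\<open>sorted_key_list_of_set\<close> is only meaningful for an injective key.\<close>

lemma (in linorder) sorted_key_list_of_set_inj:
  assumes "finite C" and "inj_on f C"
  shows "set (sorted_key_list_of_set f C) = C"
    and "distinct (map f (sorted_key_list_of_set f C))"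
    and "sorted (map f (sorted_key_list_of_set f C))"
proof -
  interpret folding_insort_key "(\<le>)" "(<)" C f
    using assms(2) by unfold_locales
  show "set (sorted_key_list_of_set f C) = C"
    by (rule set_sorted_key_list_of_set) (use assms(1) in auto)
  show "distinct (map f (sorted_key_list_of_set f C))"
    by (rule distinct_sorted_key_list_of_set) auto
  show "sorted (map f (sorted_key_list_of_set f C))"
    by (rule sorted_sorted_key_list_of_set) auto
qed

lemma increasing_cells:
  assumes C: "finite C" and fin: "\<And>A B. (A, B) \<in> C \<Longrightarrow> finite A \<and> finite B"
  shows "set (increasing_cells C) = C"
    and "sorted_wrt (\<lambda>a b. cell_key a < cell_key b) (increasing_cells C)"
proof -
  have inj: "inj_on cell_key C"
    unfolding inj_on_def cell_key_def
    by (metis fin fst_conv snd_conv prod.collapse set_sorted_list_of_set)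
  show "set (increasing_cells C) = C"
    unfolding increasing_cells_def by (rule sorted_key_list_of_set_inj[OF C inj])
  have "sorted_wrt (<) (map cell_key (increasing_cells C))"
    unfolding increasing_cells_def strict_sorted_iff
    by (intro conjI sorted_key_list_of_set_inj C inj)
  then show "sorted_wrt (\<lambda>a b. cell_key a < cell_key b) (increasing_cells C)"
    by (simp add: sorted_wrt_map)
qed

text \<open>The vertex \<open>u\<close> is added to the first coordinate if \<open>r = 1\<close> and to the second one if
  \<open>r = 2\<close>.\<close>

definition add_vertex :: "nat \<Rightarrow> nat \<Rightarrow> cell \<Rightarrow> cell" where
  "add_vertex r u c =
     (if r = 1 then (insert u (fst c), snd c) else (fst c, insert u (snd c)))"

definition add_vertex_defined :: "cell set \<Rightarrow> nat \<Rightarrow> nat \<Rightarrow> cell \<Rightarrow> bool" where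
  "add_vertex_defined X r u c \<longleftrightarrow> u \<notin> fst c \<union> snd c \<and> add_vertex r u c \<in> X"

text \<open>A state consists of the current sets \<open>A\<^sup>p\<close> and the current field \<open>W\<close>, in which
  \<open>(\<alpha>, \<beta>)\<close> stands for the pairing \<open>\<alpha> \<nearrow> \<beta>\<close>.\<close>

type_synonym state = "(nat \<Rightarrow> cell set) \<times> (cell \<times> cell) set"

definition pair_step :: "cell set \<Rightarrow> nat \<Rightarrow> nat \<Rightarrow> nat \<Rightarrow> cell \<Rightarrow> state \<Rightarrow> state" where
  "pair_step X p r u \<alpha> = (\<lambda>(A, W). let \<beta> = add_vertex r u \<alpha> in
     if add_vertex_defined X r u \<alpha> \<and> \<alpha> \<in> A p \<and> \<beta> \<in> A (p + 1)
     then (A(p := A p - {\<alpha>}, p + 1 := A (p + 1) - {\<beta>}), insert (\<alpha>, \<beta>) W)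
     else (A, W))"

definition cell_loop :: "cell set \<Rightarrow> nat \<Rightarrow> nat \<Rightarrow> nat \<Rightarrow> state \<Rightarrow> state" where
  "cell_loop X p r u s = fold (pair_step X p r u) (increasing_cells (fst s p)) s"

definition vertex_loop :: "nat \<Rightarrow> cell set \<Rightarrow> nat \<Rightarrow> nat \<Rightarrow> state \<Rightarrow> state" where
  "vertex_loop m X p r = fold (cell_loop X p r) (rev [0..<m + 1])"

definition coordinate_loop :: "nat \<Rightarrow> cell set \<Rightarrow> nat \<Rightarrow> state \<Rightarrow> state" where
  "coordinate_loop m X p s =
     (if fst s p \<noteq> {} \<and> fst s (p + 1) \<noteq> {} then fold (vertex_loop m X p) [2, 1] s else s)"

definition gradient_field_on :: "nat \<Rightarrow> cell set \<Rightarrow> (cell \<times> cell) set" where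
  "gradient_field_on m X =
     snd (fold (coordinate_loop m X) (rev [0..<Max (cell_dim ` X)])
       (\<lambda>p. {c \<in> X. cell_dim c = p}, {}))"

definition DConf_skeleton :: "nat \<Rightarrow> nat \<Rightarrow> cell set" where
  "DConf_skeleton m d = DConf2 (skeleton d (simplex m))"

definition gradient_field :: "nat \<Rightarrow> nat \<Rightarrow> (cell \<times> cell) set" where
  "gradient_field m d = gradient_field_on m (DConf_skeleton m d)"

definition is_critical :: "cell set \<Rightarrow> (cell \<times> cell) set \<Rightarrow> cell \<Rightarrow> bool" where
  "is_critical X W c \<longleftrightarrow> c \<in> X \<and> (\<forall>(\<alpha>, \<beta>) \<in> W. c \<noteq> \<alpha> \<and> c \<noteq> \<beta>)"

section \<open>The list of critical cells\<close>

definition critical_type :: "nat \<Rightarrow> nat \<Rightarrow> nat \<Rightarrow> nat set \<Rightarrow> nat set \<Rightarrow> bool" where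
  "critical_type m d i A B \<longleftrightarrow>
     (i = 1 \<and> A = {m - 1} \<and> B = {m})
   \<or> (i = 2 \<and> (\<exists>b. B = {b} \<and> b \<ge> 1 \<and> b - 1 \<notin> A \<and> {b + 1..m} \<subseteq> A \<and> card A = d + 1))
   \<or> (i = 3 \<and> A = {m} \<and> Max B < m - 1 \<and> card B = d + 1)
   \<or> (i = 4 \<and> Max B = m - 1 \<and> {0..m - 1} \<noteq> B \<and> A = {Max ({0..m - 1} - B)} \<and> card B = d + 1)
   \<or> (i = 5 \<and> Max A < m \<and> \<not> {1 + Max B..m - 1} \<subseteq> A \<and> card A = d + 1 \<and> card B = d + 1
       \<and> 2 * (d + 1) \<le> m)
   \<or> (i = 6 \<and> Max (A \<union> B) < m \<and> {1 + Max B..m - 1} \<subseteq> A \<and> {0..Max B} \<noteq> B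
       \<and> Max ({0..Max B} - B) \<notin> A \<and> card A = d + 1 \<and> card B = d + 1 \<and> 2 * (d + 1) < m)
   \<or> (i = 7 \<and> A = {d + 1..m - 1} \<and> B = {0..d} \<and> m \<le> 2 * (d + 1))"

definition critical_type_dim :: "nat \<Rightarrow> nat \<Rightarrow> nat \<Rightarrow> nat" where
  "critical_type_dim m d i =
     (if i = 1 then 0 else if i \<in> {2, 3, 4} then d else if i \<in> {5, 6} then 2 * d else m - 2)"

end

theory Submission
  imports Defs
begin

text \<open>The pass with parameters \<open>(p, r, u)\<close> is insensitive to the order of the cells, and the field
  produced by the greedy passes is the only matching in which every available pairing
  \<open>\<alpha> \<nearrow> \<alpha> +\<^sub>r u\<close> is either taken, or blocked by an earlier pairing of \<open>\<alpha>\<close> or \<open>\<alpha> +\<^sub>r u\<close>, or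
  blocked because \<open>\<alpha> +\<^sub>r u\<close> is already the lower end of a pairing one dimension up. Such a matching
  can be written down: each cell \<open>(A, B)\<close> has a pivot \<open>(r, u)\<close>, computed from
  \<open>t = max (\<langle>0,m\<rangle> - A)\<close> and \<open>max B\<close>, and the pivot does not change when \<open>u\<close> is toggled in the
  \<open>r\<close>-th coordinate. The critical cells are those without a pivot and those where toggling would make
  a coordinate empty or too large.\<close>

section \<open>Greedy matchings\<close>

text \<open>Adding \<open>u\<close> to coordinate \<open>r\<close> is injective on cells avoiding
  \<open>u\<close>, so the candidate pairings of one pass are pairwise disjoint: taking one leaves
  the others available.\<close>

lemma fold_pair_step:
  assumes "distinct cs"
  shows "fold (pair_step X p r u) cs (A, W) =
    (let P = {c \<in> set cs. add_vertex_defined X r u c \<and> c \<in> A p \<and> add_vertex r u c \<in> A (p + 1)}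
     in (A(p := A p - P, p + 1 := A (p + 1) - add_vertex r u ` P),
         (\<lambda>c. (c, add_vertex r u c)) ` P \<union> W))"
  using assms
proof (induction cs arbitrary: A W)
  case Nil
  then show ?case by (simp add: fun_eq_iff)
next
  case (Cons x cs)
  let ?a = "add_vertex r u"
  let ?P = "\<lambda>cs A. {c \<in> set cs. add_vertex_defined X r u c \<and> c \<in> A p \<and> ?a c \<in> A (p + 1)}"
  have inj: "c = x" if "add_vertex_defined X r u c" "add_vertex_defined X r u x" "?a c = ?a x" for c
    using that by (cases c; cases x)
      (auto simp: add_vertex_defined_def add_vertex_def insert_ident split: if_splits)
  show ?case
  proof (cases "add_vertex_defined X r u x \<and> x \<in> A p \<and> ?a x \<in> A (p + 1)")
    case True
    let ?A = "A(p := A p - {x}, p + 1 := A (p + 1) - {?a x})"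
    have "pair_step X p r u x (A, W) = (?A, insert (x, ?a x) W)"
      using True by (simp add: pair_step_def Let_def)
    moreover have "?P cs ?A = ?P cs A"
      using inj True Cons.prems by auto
    moreover have "?P (x # cs) A = insert x (?P cs A)"
      using True by auto
    ultimately show ?thesis
      using Cons by (auto simp: Let_def fun_eq_iff)
  next
    case False
    then have "pair_step X p r u x (A, W) = (A, W)"
      by (auto simp: pair_step_def Let_def)
    moreover have "?P (x # cs) A = ?P cs A"
      using False by auto
    ultimately show ?thesis
      using Cons by simp
  qed
qed

text \<open>Strictly increasing keys make the list of cells distinct, so
  \<open>fold_pair_step\<close> applies with the list ranging over all of
  \<open>A p\<close>.\<close>

lemma cell_loop_eq:
  assumes "finite (A p)" and "\<And>B C. (B, C) \<in> A p \<Longrightarrow> finite B \<and> finite C"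
    and "P = {c \<in> A p. add_vertex_defined X r u c \<and> add_vertex r u c \<in> A (p + 1)}"
  shows "cell_loop X p r u (A, W) =
    (A(p := A p - P, p + 1 := A (p + 1) - add_vertex r u ` P),
     (\<lambda>c. (c, add_vertex r u c)) ` P \<union> W)"
proof -
  note inc = increasing_cells[OF assms(1,2)]
  have "distinct (increasing_cells (A p))"
    using inc(2) by (metis distinct_map strict_sorted_iff sorted_wrt_map)
  then show ?thesis
    using inc(1) unfolding cell_loop_def
    by (simp add: fold_pair_step Let_def assms(3) conj_commute conj_left_commute cong: conj_cong)
qed

section \<open>The passes of one stage and their order\<close>

definition steps :: "nat \<Rightarrow> (nat \<times> nat) list" where
  "steps m = map (Pair 2) (rev [0..<m + 1]) @ map (Pair 1) (rev [0..<m + 1])"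

text \<open>Execution order: the pass \<open>x\<close> runs earlier than the pass
  \<open>y\<close>.\<close>

definition before :: "nat \<times> nat \<Rightarrow> nat \<times> nat \<Rightarrow> bool" where
  "before x y \<longleftrightarrow> fst y < fst x \<or> fst x = fst y \<and> snd y < snd x"

lemma set_steps: "set (steps m) = {1, 2} \<times> {..m}"
  by (auto simp: steps_def less_Suc_eq_le)

lemma sorted_steps: "sorted_wrt before (steps m)"
  by (auto simp: steps_def sorted_wrt_append sorted_wrt_map before_def sorted_wrt_rev
      sorted_wrt_upt simp del: upt_Suc)

lemma fold_vertex_loop:
  "fold (vertex_loop m X p) [2, 1] s = fold (\<lambda>(r, u). cell_loop X p r u) (steps m) s"
  by (simp add: vertex_loop_def steps_def fold_map o_def del: upt_Suc)

text \<open>\<open>L r u c\<close> means that \<open>c\<close> is the lower end of the pairing \<open>c \<nearrow> c +\<^sub>r u\<close>.\<close>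

locale greedy_matching =
  fixes m :: nat and X :: "cell set" and L :: "nat \<Rightarrow> nat \<Rightarrow> cell \<Rightarrow> bool"
  assumes finite_X: "finite X"
    and cellD: "(A, B) \<in> X \<Longrightarrow> A \<noteq> {} \<and> B \<noteq> {} \<and> finite A \<and> finite B"
    and L_D: "L r u c \<Longrightarrow> c \<in> X \<and> r \<in> {1, 2} \<and> u \<le> m \<and> add_vertex_defined X r u c"
    and lower_unique: "L r u c \<Longrightarrow> L r' u' c \<Longrightarrow> (r', u') = (r, u)"
    and upper_not_lower: "L r u c \<Longrightarrow> \<not> L r' u' (add_vertex r u c)"
    and upper_unique: "L r u c \<Longrightarrow> L r' u' c' \<Longrightarrow> add_vertex r' u' c' = add_vertex r u c \<Longrightarrow>
      (r', u') = (r, u)"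
    and greedy: "r \<in> {1, 2} \<Longrightarrow> u \<le> m \<Longrightarrow> c \<in> X \<Longrightarrow> add_vertex_defined X r u c \<Longrightarrow>
      L r u c \<or> (\<exists>r' u'. L r' u' (add_vertex r u c)) \<or>
      (\<exists>r' u' c'. before (r', u') (r, u) \<and> L r' u' c' \<and>
         (c' = c \<or> add_vertex r' u' c' = add_vertex r u c))"
begin

section \<open>Invariants of stages and passes\<close>

lemma cell_dim_add_vertex:
  assumes "c \<in> X" "add_vertex_defined X r u c"
  shows "cell_dim (add_vertex r u c) = cell_dim c + 1"
proof -
  obtain A B where c: "c = (A, B)" by fastforce
  then have "A \<noteq> {}" "B \<noteq> {}" "finite A" "finite B"
    using assms(1) cellD by blast+
  then have "card A > 0" "card B > 0"
    by (simp_all add: card_gt_0_iff)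
  then show ?thesis
    using assms c \<open>finite A\<close> \<open>finite B\<close>
    by (auto simp: add_vertex_def add_vertex_defined_def cell_dim_def simplex_dim_def)
qed

lemma L_dim: "L r u c \<Longrightarrow> cell_dim (add_vertex r u c) = cell_dim c + 1"
  using L_D cell_dim_add_vertex by blast

text \<open>The state once all stages of index at least \<open>p\<close> are done. Sets
  \<open>A q\<close> with \<open>q > p\<close> are left open, since later stages do not consult
  them.\<close>

definition stage_inv :: "nat \<Rightarrow> state \<Rightarrow> bool" where
  "stage_inv p = (\<lambda>(A, W).
     (\<forall>q<p. A q = {c \<in> X. cell_dim c = q})
   \<and> A p = {c \<in> X. cell_dim c = p \<and> \<not> (\<exists>r u. L r u c)}
   \<and> W = {(c, add_vertex r u c) | r u c. L r u c \<and> p \<le> cell_dim c})"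

text \<open>The state inside stage \<open>p\<close>, with \<open>S\<close> the set of passes already
  executed. The set \<open>A (p + 1)\<close> lost its lower ends in the preceding stage and loses
  its upper ends now.\<close>

definition step_inv :: "nat \<Rightarrow> (nat \<times> nat) set \<Rightarrow> state \<Rightarrow> bool" where
  "step_inv p S = (\<lambda>(A, W).
     (\<forall>q<p. A q = {c \<in> X. cell_dim c = q})
   \<and> A p = {c \<in> X. cell_dim c = p \<and> \<not> (\<exists>r u. (r, u) \<in> S \<and> L r u c)}
   \<and> A (p + 1) = {c \<in> X. cell_dim c = p + 1 \<and> \<not> (\<exists>r u. L r u c)
        \<and> \<not> (\<exists>r u c'. (r, u) \<in> S \<and> L r u c' \<and> c = add_vertex r u c')}
   \<and> W = {(c, add_vertex r u c) | r u c.
        L r u c \<and> (p < cell_dim c \<or> cell_dim c = p \<and> (r, u) \<in> S)})"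

text \<open>The candidates \<open>P\<close> of the pass are exactly the lower ends that
  \<open>L\<close> prescribes for it: \<open>greedy\<close> gives one inclusion, uniqueness of the
  pairing of a cell the other.\<close>

lemma step_inv_cell_loop:
  assumes inv: "step_inv p (set xs) s" and steps: "steps m = xs @ (r, u) # ys"
  shows "step_inv p (set (xs @ [(r, u)])) (cell_loop X p r u s)"
proof -
  obtain A W where s: "s = (A, W)" by fastforce
  define P where "P = {c \<in> A p. add_vertex_defined X r u c \<and> add_vertex r u c \<in> A (p + 1)}"
  have sw: "sorted_wrt before (xs @ (r, u) # ys)" and ru: "r \<in> {1, 2}" "u \<le> m"
    using sorted_steps[of m] set_steps[of m] unfolding steps by auto
  have new: "(r, u) \<notin> set xs"
    using sw by (auto simp: sorted_wrt_append before_def)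
  have old: "(r', u') \<in> set xs" if "before (r', u') (r, u)" "r' \<in> {1, 2}" "u' \<le> m" for r' u'
  proof -
    have "(r', u') \<in> set (xs @ (r, u) # ys)"
      unfolding steps[symmetric] set_steps using that by simp
    then show ?thesis
      using sw that(1) by (auto simp: sorted_wrt_append before_def)
  qed
  have Aq: "\<And>q. q < p \<Longrightarrow> A q = {c \<in> X. cell_dim c = q}"
    and Ap: "A p = {c \<in> X. cell_dim c = p \<and> \<not> (\<exists>r u. (r, u) \<in> set xs \<and> L r u c)}"
    and Ap1: "A (p + 1) = {c \<in> X. cell_dim c = p + 1 \<and> \<not> (\<exists>r u. L r u c)
        \<and> \<not> (\<exists>r u c'. (r, u) \<in> set xs \<and> L r u c' \<and> c = add_vertex r u c')}"
    and W: "W = {(c, add_vertex r u c) | r u c.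
        L r u c \<and> (p < cell_dim c \<or> cell_dim c = p \<and> (r, u) \<in> set xs)}"
    using inv by (simp_all add: s step_inv_def)
  have P: "P = {c. L r u c \<and> cell_dim c = p}"
  proof (intro equalityI subsetI)
    fix c assume "c \<in> P"
    then have c: "c \<in> X" "cell_dim c = p" "add_vertex_defined X r u c"
      and nl: "\<And>r u. (r, u) \<in> set xs \<Longrightarrow> \<not> L r u c"
      and nu: "\<And>r' u'. \<not> L r' u' (add_vertex r u c)"
        "\<And>r' u' c'. (r', u') \<in> set xs \<Longrightarrow> L r' u' c' \<Longrightarrow> add_vertex r u c \<noteq> add_vertex r' u' c'"
      unfolding P_def Ap Ap1 mem_Collect_eq by blast+
    \<comment> \<open>A blocking pairing would belong to an earlier pass, which would already have
      removed \<open>c\<close> or \<open>add_vertex r u c\<close>.\<close>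
    have False if "before (r', u') (r, u)" "L r' u' c'"
      "c' = c \<or> add_vertex r' u' c' = add_vertex r u c" for r' u' c'
      using old[OF that(1)] L_D[OF that(2)] that(2,3) nl nu(2) by metis
    then have "L r u c"
      using greedy[OF ru c(1,3)] nu(1) by blast
    then show "c \<in> {c. L r u c \<and> cell_dim c = p}"
      using c by simp
  next
    \<comment> \<open>Conversely, no earlier pass took either end, because each cell has only one
      pairing and it belongs to the pass \<open>(r, u)\<close>.\<close>
    fix c assume "c \<in> {c. L r u c \<and> cell_dim c = p}"
    then have c: "L r u c" "cell_dim c = p" by auto
    have "\<not> L r' u' c" if "(r', u') \<in> set xs" for r' u'
      using lower_unique[OF c(1)] that new by metis
    moreover have "add_vertex r u c \<noteq> add_vertex r' u' c'"
      if "(r', u') \<in> set xs" "L r' u' c'" for r' u' c'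
      using upper_unique[OF c(1) that(2)] that new by metis
    moreover have "add_vertex r u c \<in> X"
      using L_D[OF c(1)] by (simp add: add_vertex_defined_def)
    ultimately show "c \<in> P"
      unfolding P_def Ap Ap1
      using L_D[OF c(1)] c(2) L_dim[OF c(1)] upper_not_lower[OF c(1)] by blast
  qed
  have "cell_loop X p r u (A, W) = (A(p := A p - P, p + 1 := A (p + 1) - add_vertex r u ` P),
      (\<lambda>c. (c, add_vertex r u c)) ` P \<union> W)"
    by (rule cell_loop_eq) (use finite_X cellD P_def in \<open>auto simp: Ap\<close>)
  moreover have "A p - P = {c \<in> X. cell_dim c = p
      \<and> \<not> (\<exists>r' u'. (r', u') \<in> set (xs @ [(r, u)]) \<and> L r' u' c)}"
    unfolding Ap P by auto
  moreover have "A (p + 1) - add_vertex r u ` P = {c \<in> X. cell_dim c = p + 1 \<and> \<not> (\<exists>r u. L r u c)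
      \<and> \<not> (\<exists>r' u' c'. (r', u') \<in> set (xs @ [(r, u)]) \<and> L r' u' c' \<and> c = add_vertex r' u' c')}"
  proof -
    \<comment> \<open>An upper end of dimension \<open>p + 1\<close> has its lower end in dimension
      \<open>p\<close>, so the dimension condition in \<open>P\<close> holds automatically.\<close>
    have "x \<in> add_vertex r u ` P \<longleftrightarrow> (\<exists>c. L r u c \<and> x = add_vertex r u c)"
      if "cell_dim x = p + 1" for x
    proof -
      have "cell_dim c = p" if "L r u c" "x = add_vertex r u c" for c
        using L_dim[OF that(1)] that(2) \<open>cell_dim x = p + 1\<close> by simp
      then show ?thesis
        unfolding P by blast
    qed
    then have "(\<exists>r' u' c. (r', u') \<in> set (xs @ [(r, u)]) \<and> L r' u' c \<and> x = add_vertex r' u' c)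
        \<longleftrightarrow> (\<exists>r u c. (r, u) \<in> set xs \<and> L r u c \<and> x = add_vertex r u c) \<or> x \<in> add_vertex r u ` P"
      if "cell_dim x = p + 1" for x
      using that by (simp del: split_paired_Ex) metis
    then show ?thesis
      unfolding Ap1 by blast
  qed
  moreover have "(\<lambda>c. (c, add_vertex r u c)) ` P \<union> W = {(c, add_vertex r' u' c) | r' u' c.
      L r' u' c \<and> (p < cell_dim c \<or> cell_dim c = p \<and> (r', u') \<in> set (xs @ [(r, u)]))}"
  proof -
    have "L r' u' c \<and> (p < cell_dim c \<or> cell_dim c = p \<and> (r', u') \<in> set (xs @ [(r, u)])) \<longleftrightarrow>
        L r' u' c \<and> (p < cell_dim c \<or> cell_dim c = p \<and> (r', u') \<in> set xs)
        \<or> r' = r \<and> u' = u \<and> c \<in> P" for r' u' c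
      by (auto simp: P)
    then show ?thesis
      unfolding W by blast
  qed
  ultimately show ?thesis
    unfolding s step_inv_def using Aq by simp
qed

lemma step_inv_fold:
  assumes "steps m = xs @ ys" "step_inv p {} s"
  shows "step_inv p (set xs) (fold (\<lambda>(r, u). cell_loop X p r u) xs s)"
  using assms(1)
proof (induction xs arbitrary: ys rule: rev_induct)
  case Nil
  then show ?case using assms(2) by simp
next
  case (snoc x xs)
  then show ?case
    using step_inv_cell_loop[of p xs _ "fst x" "snd x" ys] by (simp add: case_prod_beta)
qed

lemma stage_inv_coordinate_loop:
  assumes inv: "stage_inv (p + 1) s"
  shows "stage_inv p (coordinate_loop m X p s)"
proof -
  obtain A W where s: "s = (A, W)" by fastforce
  have A: "\<And>q. q \<le> p \<Longrightarrow> A q = {c \<in> X. cell_dim c = q}"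
    and Ap1: "A (p + 1) = {c \<in> X. cell_dim c = p + 1 \<and> \<not> (\<exists>r u. L r u c)}"
    and W: "W = {(c, add_vertex r u c) | r u c. L r u c \<and> p < cell_dim c}"
    using inv by (simp_all add: s stage_inv_def less_Suc_eq_le Suc_le_eq)
  show ?thesis
  proof (cases "A p \<noteq> {} \<and> A (p + 1) \<noteq> {}")
    case True
    have "step_inv p {} (A, W)"
      using A Ap1 by (simp add: step_inv_def W)
    then have "step_inv p (set (steps m)) (coordinate_loop m X p s)"
      using step_inv_fold[of "steps m" "[]" p s] True
      unfolding coordinate_loop_def fold_vertex_loop s by simp
    moreover have "(r, u) \<in> set (steps m) \<and> L r u c \<longleftrightarrow> L r u c" for r u c
      using L_D[of r u c] by (auto simp: set_steps)
    moreover have "L r u c \<and> (p < cell_dim c \<or> cell_dim c = p \<and> (r, u) \<in> set (steps m))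
        \<longleftrightarrow> L r u c \<and> p \<le> cell_dim c" for r u c
      using L_D[of r u c] by (auto simp: set_steps)
    ultimately show ?thesis
      unfolding stage_inv_def step_inv_def by (simp only: case_prod_beta) blast
  next
    case False
    \<comment> \<open>A skipped stage loses no pairing: both ends of one starting in dimension
      \<open>p\<close> would still be present, so neither set would be empty.\<close>
    have "cell_dim c \<noteq> p" if "L r u c" for r u c
    proof
      assume "cell_dim c = p"
      then have "c \<in> A p" "add_vertex r u c \<in> A (p + 1)"
        using L_D[OF that] A L_dim[OF that] upper_not_lower[OF that] unfolding Ap1
        by (simp_all del: One_nat_def add: add_vertex_defined_def)
      then show False
        using False by blast
    qed
    then have "L r u c \<and> p < cell_dim c \<longleftrightarrow> L r u c \<and> p \<le> cell_dim c"
      and "\<not> (cell_dim c = p \<and> L r u c)" for r u c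
      by (metis le_less)+
    moreover have "coordinate_loop m X p s = (A, W)"
      unfolding coordinate_loop_def s using False by auto
    ultimately show ?thesis
      unfolding stage_inv_def using A by (auto simp: W)
  qed
qed

lemma stage_inv_fold:
  "stage_inv n s \<Longrightarrow> stage_inv 0 (fold (coordinate_loop m X) (rev [0..<n]) s)"
  by (induction n arbitrary: s) (simp_all add: stage_inv_coordinate_loop)

theorem gradient_field_on_eq:
  "gradient_field_on m X = {(c, add_vertex r u c) | r u c. L r u c}"
proof -
  \<comment> \<open>The initial state satisfies the invariant at the top dimension, because a
    top-dimensional cell has no partner above it.\<close>
  have "cell_dim c < Max (cell_dim ` X)" if "L r u c" for r u c
  proof -
    have "cell_dim (add_vertex r u c) \<le> Max (cell_dim ` X)"
      using L_D[OF that] finite_X by (simp add: add_vertex_defined_def)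
    then show ?thesis
      using L_dim[OF that] by simp
  qed
  then have "\<not> (L r u c \<and> Max (cell_dim ` X) \<le> cell_dim c)"
    and "\<not> (cell_dim c = Max (cell_dim ` X) \<and> L r u c)" for r u c
    by (metis leD less_irrefl)+
  then have "stage_inv (Max (cell_dim ` X)) (\<lambda>p. {c \<in> X. cell_dim c = p}, {})"
    unfolding stage_inv_def prod.case by blast
  from stage_inv_fold[OF this] show ?thesis
    unfolding gradient_field_on_def stage_inv_def by (simp add: case_prod_beta)
qed

end

section \<open>The pivot of a cell\<close>

lemma Max_Diff_interval_eq:
  fixes t n :: nat
  assumes "t \<le> n" "t \<notin> A" "\<forall>x. t < x \<and> x \<le> n \<longrightarrow> x \<in> A"
  shows "Max ({0..n} - A) = t"
proof (rule Max_eqI)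
  show "y \<le> t" if "y \<in> {0..n} - A" for y
    using assms(3) that by (metis Diff_iff atLeastAtMost_iff not_le)
qed (use assms in auto)

lemma Max_Diff_interval:
  fixes n :: nat
  assumes "{0..n} - A \<noteq> {}" and "t = Max ({0..n} - A)"
  shows "t \<le> n" "t \<notin> A" "\<forall>x. t < x \<and> x \<le> n \<longrightarrow> x \<in> A"
proof -
  have "t \<in> {0..n} - A"
    unfolding assms(2) by (rule Max_in) (use assms in auto)
  then show "t \<le> n" "t \<notin> A" by auto
  show "\<forall>x. t < x \<and> x \<le> n \<longrightarrow> x \<in> A"
  proof (intro allI impI, rule ccontr)
    fix x assume "t < x \<and> x \<le> n" "x \<notin> A"
    then have "x \<le> t"
      unfolding assms(2) by (intro Max_ge) auto
    then show False using \<open>t < x \<and> x \<le> n\<close> by simp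
  qed
qed

lemma DConf_skeleton_iff:
  "(A, B) \<in> DConf_skeleton m d \<longleftrightarrow> A \<noteq> {} \<and> B \<noteq> {} \<and> A \<subseteq> {0..m} \<and> B \<subseteq> {0..m}
     \<and> A \<inter> B = {} \<and> card A \<le> d + 1 \<and> card B \<le> d + 1"
  unfolding DConf_skeleton_def DConf2_def skeleton_def simplex_def simplex_dim_def
    mem_Collect_eq prod.case mem_Times_iff fst_conv snd_conv le_diff_conv by blast

definition coord :: "nat \<Rightarrow> cell \<Rightarrow> nat set" where
  "coord r c = (if r = 1 then fst c else snd c)"

text \<open>In the first case \<open>t = 0\<close> is harmless: it would force \<open>{1..m} \<subseteq> A\<close>, but \<open>card A \<le> d + 1 < m\<close>.\<close>

definition pivot :: "nat \<Rightarrow> nat \<Rightarrow> cell \<Rightarrow> (nat \<times> nat) option" where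
  "pivot m d = (\<lambda>(A, B). let t = Max ({0..m} - A); b = Max B in
     if B = {t} then Some (1, t - 1)
     else if t \<in> B \<or> card B \<le> d then Some (2, t)
     else if \<not> {b + 1..m - 1} \<subseteq> A then Some (1, m)
     else if B \<noteq> {0..b} then Some (1, Max ({0..b} - B))
     else None)"

section \<open>Top gaps and the branches of the pivot\<close>

locale dconf =
  fixes m d :: nat
  assumes d: "1 \<le> d" and m: "d + 2 \<le> m"
begin

abbreviation "X \<equiv> DConf_skeleton m d"

text \<open>Relational form of \<open>t = Max ({0..m} - A)\<close>, which is easy to transfer to
  \<open>insert u A\<close> and \<open>A - {u}\<close>.\<close>

definition top_gap :: "nat set \<Rightarrow> nat \<Rightarrow> bool" where
  "top_gap A t \<longleftrightarrow> t \<le> m \<and> t \<notin> A \<and> (\<forall>x. t < x \<and> x \<le> m \<longrightarrow> x \<in> A)"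

lemma top_gap_m: "top_gap A m \<longleftrightarrow> m \<notin> A"
  by (auto simp: top_gap_def)

lemma top_gap_exists:
  assumes "x \<le> m" "x \<notin> A"
  obtains t where "top_gap A t" "x \<le> t"
proof
  have ne: "{0..m} - A \<noteq> {}" using assms by auto
  show "top_gap A (Max ({0..m} - A))"
    unfolding top_gap_def using Max_Diff_interval[OF ne refl] by blast
  show "x \<le> Max ({0..m} - A)"
    using assms by (intro Max_ge) auto
qed

lemma top_gap_Max: "top_gap A t \<Longrightarrow> Max ({0..m} - A) = t"
  unfolding top_gap_def by (rule Max_Diff_interval_eq) auto

lemma pivot_singleton: "top_gap A t \<Longrightarrow> pivot m d (A, {t}) = Some (1, t - 1)"
  by (simp add: pivot_def top_gap_Max)

lemma pivot_snd: "top_gap A t \<Longrightarrow> B \<noteq> {t} \<Longrightarrow> t \<in> B \<or> card B \<le> d \<Longrightarrow> pivot m d (A, B) = Some (2, t)"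
  by (simp add: pivot_def top_gap_Max Let_def)

lemma pivot_fst_m:
  assumes "top_gap A t" "t \<notin> B" "card B = d + 1" "Max B < x" "x < m" "x \<notin> A"
  shows "pivot m d (A, B) = Some (1, m)"
proof -
  have "x \<in> {Max B + 1..m - 1}" using assms(4,5) by auto
  then have "\<not> {Max B + 1..m - 1} \<subseteq> A" using assms(6) by blast
  moreover have "B \<noteq> {t}" using assms(2) by blast
  ultimately show ?thesis
    using assms(1-3) by (simp add: pivot_def top_gap_Max Let_def)
qed

lemma pivot_fst_gap:
  assumes "top_gap A t" "t \<notin> B" "card B = d + 1" "\<forall>x. Max B < x \<and> x < m \<longrightarrow> x \<in> A"
    and "v < Max B" "v \<notin> B" "\<forall>x. v < x \<and> x \<le> Max B \<longrightarrow> x \<in> B"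
  shows "pivot m d (A, B) = Some (1, v)"
proof -
  have "{Max B + 1..m - 1} \<subseteq> A" using assms(4) by auto
  moreover have "B \<noteq> {0..Max B}" using assms(5,6) by auto
  moreover have "Max ({0..Max B} - B) = v"
    by (rule Max_Diff_interval_eq) (use assms in auto)
  ultimately show ?thesis
    using assms(1-3) by (auto simp: pivot_def top_gap_Max Let_def)
qed

lemma finite_cell: "(A, B) \<in> X \<Longrightarrow> finite A \<and> finite B"
  by (auto simp: DConf_skeleton_iff intro: finite_subset)

lemma top_gap_of_cell:
  assumes "(A, B) \<in> X"
  obtains t where "top_gap A t"
proof -
  have "card A < card {0..m}" using assms m by (simp add: DConf_skeleton_iff)
  then have "\<not> {0..m} \<subseteq> A"
    using card_mono[of A "{0..m}"] finite_cell[OF assms] by linarith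
  then show ?thesis
    using top_gap_exists that by (meson atLeastAtMost_iff subsetI)
qed

text \<open>All vertices above \<open>t\<close> lie in \<open>A\<close>, hence outside
  \<open>B\<close>.\<close>

lemma Max_less_top_gap:
  assumes "(A, B) \<in> X" "top_gap A t" "t \<notin> B"
  shows "Max B < t"
proof -
  have "x < t" if "x \<in> B" for x
    using assms that by (metis DConf_skeleton_iff IntI atLeastAtMost_iff empty_iff in_mono
        linorder_neqE_nat top_gap_def)
  moreover have "finite B" "B \<noteq> {}"
    using assms(1) finite_cell[OF assms(1)] by (simp_all add: DConf_skeleton_iff)
  ultimately show ?thesis by simp
qed

text \<open>Case rule for the branches of \<open>pivot\<close>, enriched by the order facts each
  branch forces. When \<open>B\<close> is full and avoids the top gap, it lies entirely below that
  gap.\<close>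

lemma pivot_cases:
  assumes c: "(A, B) \<in> X"
  obtains (singleton) t where "top_gap A t" "B = {t}" "1 \<le> t" "pivot m d (A, B) = Some (1, t - 1)"
  | (snd) t where "top_gap A t" "B \<noteq> {t}" "t \<in> B \<or> card B \<le> d" "pivot m d (A, B) = Some (2, t)"
  | (fst_m) t x where "top_gap A t" "t \<notin> B" "card B = d + 1" "Max B < t"
      "Max B < x" "x < m" "x \<notin> A" "m \<notin> B" "pivot m d (A, B) = Some (1, m)"
  | (fst_gap) v where "top_gap A m" "m \<notin> B" "card B = d + 1" "Max B < m"
      "\<forall>x. Max B < x \<and> x < m \<longrightarrow> x \<in> A"
      "v < Max B" "v \<notin> B" "\<forall>x. v < x \<and> x \<le> Max B \<longrightarrow> x \<in> B" "pivot m d (A, B) = Some (1, v)"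
  | (none) "top_gap A m" "m \<notin> B" "card B = d + 1" "Max B < m"
      "\<forall>x. Max B < x \<and> x < m \<longrightarrow> x \<in> A" "B = {0..Max B}" "pivot m d (A, B) = None"
proof -
  have cell: "A \<noteq> {}" "B \<noteq> {}" "A \<subseteq> {0..m}" "B \<subseteq> {0..m}" "A \<inter> B = {}"
    "card A \<le> d + 1" "card B \<le> d + 1" and fin: "finite A" "finite B"
    using c finite_cell[OF c] by (auto simp: DConf_skeleton_iff)
  obtain t where t: "top_gap A t" using top_gap_of_cell[OF c] .
  show ?thesis
  proof (cases "B = {t} \<or> t \<in> B \<or> card B \<le> d")
    case True
    have "1 \<le> t" if "B = {t}"
    proof (rule ccontr)
      assume "\<not> 1 \<le> t"
      then have "{1..m} \<subseteq> A" using t by (auto simp: top_gap_def)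
      then show False
        using card_mono[of A "{1..m}"] fin cell m by auto
    qed
    then show ?thesis
      using True singleton[OF t] snd[OF t] pivot_singleton[OF t] pivot_snd[OF t, of B]
      by (cases "B = {t}") simp_all
  next
    case False
    then have tB: "t \<notin> B" "card B = d + 1" using cell by auto
    have b: "Max B < t" using Max_less_top_gap[OF c t tB(1)] .
    have "t \<le> m" using t by (simp add: top_gap_def)
    have mB: "m \<notin> B"
    proof
      assume "m \<in> B"
      then have "m \<le> Max B" using fin by simp
      then show False using b \<open>t \<le> m\<close> by simp
    qed
    show ?thesis
    proof (cases "\<exists>x. Max B < x \<and> x < m \<and> x \<notin> A")
      case True
      then show ?thesis
        using fst_m[OF t tB b] pivot_fst_m[OF t tB] mB by blast
    next
      case full: False
      \<comment> \<open>A gap above \<open>Max B\<close> and below \<open>m\<close> would contradict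
        \<open>full\<close>.\<close>
      then have tm: "t = m"
        using b t by (metis le_neq_implies_less top_gap_def)
      show ?thesis
      proof (cases "B = {0..Max B}")
        case True
        have "{Max B + 1..m - 1} \<subseteq> A" using full by auto
        then have "pivot m d (A, B) = None"
          using False True t by (simp add: pivot_def top_gap_Max Let_def)
        then show ?thesis
          using none t tm tB mB b full True by blast
      next
        case False
        have ne: "{0..Max B} - B \<noteq> {}"
          using False fin by (auto simp: set_eq_iff)
        define v where "v = Max ({0..Max B} - B)"
        note v = Max_Diff_interval[OF ne v_def]
        have "v < Max B"
          using v(1,2) Max_in[OF fin(2) cell(2)] by (metis le_neq_implies_less)
        then show ?thesis
          using fst_gap[of v] pivot_fst_gap[OF t tB _ _ v(2,3)] t tm tB mB b full v by blast
      qed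
    qed
  qed
qed

section \<open>Toggling the pivot\<close>

text \<open>The size bound leaves room for adding the pivot.\<close>

definition lower_at :: "nat \<Rightarrow> nat \<Rightarrow> cell \<Rightarrow> bool" where
  "lower_at r u c \<longleftrightarrow> c \<in> X \<and> pivot m d c = Some (r, u) \<and> u \<notin> coord r c \<and> card (coord r c) \<le> d"

text \<open>Excluding \<open>{u}\<close> keeps the coordinate nonempty after the pivot is
  removed.\<close>

definition upper_at :: "nat \<Rightarrow> nat \<Rightarrow> cell \<Rightarrow> bool" where
  "upper_at r u c \<longleftrightarrow> c \<in> X \<and> pivot m d c = Some (r, u) \<and> u \<in> coord r c \<and> coord r c \<noteq> {u}"

text \<open>Adding the pivot does not change it: in each branch the data that determine the pivot
  survive the insertion.\<close>

lemma lower_at_D: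
  assumes "lower_at r u c"
  shows "r \<in> {1, 2} \<and> u \<le> m \<and> u \<notin> fst c \<union> snd c \<and> upper_at r u (add_vertex r u c)"
proof -
  obtain A B where c: "c = (A, B)" by fastforce
  have X: "(A, B) \<in> X" and piv: "pivot m d (A, B) = Some (r, u)"
    and u: "u \<notin> coord r (A, B)" "card (coord r (A, B)) \<le> d"
    using assms by (auto simp: lower_at_def c)
  have cell: "A \<noteq> {}" "B \<noteq> {}" "A \<subseteq> {0..m}" "B \<subseteq> {0..m}" "A \<inter> B = {}"
    "card A \<le> d + 1" "card B \<le> d + 1" and fin: "finite A" "finite B"
    using X finite_cell[OF X] by (auto simp: DConf_skeleton_iff)
  have newA: "(insert x A, B) \<in> X" if "x \<le> m" "x \<notin> B" "card A \<le> d" for x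
    using that cell fin by (auto simp: DConf_skeleton_iff card_insert_if)
  have newB: "(A, insert x B) \<in> X" if "x \<le> m" "x \<notin> A" "card B \<le> d" for x
    using that cell fin by (auto simp: DConf_skeleton_iff card_insert_if)
  have neA: "insert x A \<noteq> {x}" if "x \<notin> A" for x using that cell by auto
  have neB: "insert x B \<noteq> {x}" if "x \<notin> B" for x using that cell by auto
  from X show ?thesis
  proof (cases rule: pivot_cases)
    case (singleton t)
    then have r: "r = 1" "u = t - 1" using piv by auto
    have "top_gap (insert u A) t" using singleton r by (auto simp: top_gap_def)
    moreover have "u \<le> m" "u \<notin> B" using singleton r by (auto simp: top_gap_def)
    ultimately show ?thesis
      using singleton r u newA neA pivot_singleton
      by (auto simp: c upper_at_def coord_def add_vertex_def)
  next
    case (snd t)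
    then have r: "r = 2" "u = t" using piv by auto
    then have "t \<notin> B" "t \<le> m" "t \<notin> A"
      using u snd by (auto simp: coord_def top_gap_def)
    then show ?thesis
      using snd r u newB neB pivot_snd[of A t "insert t B"]
      by (auto simp: c upper_at_def coord_def add_vertex_def)
  next
    case (fst_m t x)
    then have r: "r = 1" "u = m" using piv by auto
    \<comment> \<open>Adding \<open>m\<close> may move the top gap, but \<open>x\<close> is still
      missing, so the new gap is at least \<open>x > Max B\<close> and stays outside
      \<open>B\<close>.\<close>
    obtain t' where t': "top_gap (insert m A) t'" "x \<le> t'"
      using top_gap_exists[of x "insert m A"] fst_m by auto
    have "t' \<notin> B" using t'(2) fst_m(5) fin by (meson Max_ge leD le_trans less_le_trans)
    then have "pivot m d (insert m A, B) = Some (1, m)"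
      using pivot_fst_m[OF t'(1)] fst_m by auto
    then show ?thesis
      using fst_m r u newA neA by (auto simp: c upper_at_def coord_def add_vertex_def)
  next
    case (fst_gap v)
    then have r: "r = 1" "u = v" using piv by auto
    have "top_gap (insert v A) m" using fst_gap by (auto simp: top_gap_def)
    then have "pivot m d (insert v A, B) = Some (1, v)"
      using pivot_fst_gap fst_gap by auto
    then show ?thesis
      using fst_gap r u newA neA by (auto simp: c upper_at_def coord_def add_vertex_def)
  next
    case none
    then show ?thesis using piv by simp
  qed
qed

text \<open>Dually, removing the pivot does not change it, so every \<open>upper_at\<close> cell is
  the upper end of a pairing.\<close>

lemma upper_at_D:
  assumes "upper_at r u c"
  shows "\<exists>c'. lower_at r u c' \<and> add_vertex r u c' = c"
proof -
  obtain A B where c: "c = (A, B)" by fastforce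
  have X: "(A, B) \<in> X" and piv: "pivot m d (A, B) = Some (r, u)"
    and u: "u \<in> coord r (A, B)" "coord r (A, B) \<noteq> {u}"
    using assms by (auto simp: upper_at_def c)
  have cell: "A \<noteq> {}" "B \<noteq> {}" "A \<subseteq> {0..m}" "B \<subseteq> {0..m}" "A \<inter> B = {}"
    "card A \<le> d + 1" "card B \<le> d + 1" and fin: "finite A" "finite B"
    using X finite_cell[OF X] by (auto simp: DConf_skeleton_iff)
  have remA: "(A - {x}, B) \<in> X \<and> card (A - {x}) \<le> d" if "A \<noteq> {x}" "x \<in> A" for x
    using that cell fin by (auto simp: DConf_skeleton_iff)
  have remB: "(A, B - {x}) \<in> X \<and> card (B - {x}) \<le> d" if "B \<noteq> {x}" "x \<in> B" for x
    using that cell fin by (auto simp: DConf_skeleton_iff)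
  have lowerA: ?thesis if "r = 1" "pivot m d (A - {u}, B) = Some (1, u)"
    by (rule exI[of _ "(A - {u}, B)"])
      (use that u remA[of u] in \<open>auto simp: c lower_at_def coord_def add_vertex_def\<close>)
  from X show ?thesis
  proof (cases rule: pivot_cases)
    case (singleton t)
    then have r: "r = 1" "u = t - 1" using piv by auto
    have "top_gap (A - {u}) t" using singleton r by (auto simp: top_gap_def)
    then show ?thesis
      using singleton r pivot_singleton lowerA by auto
  next
    case (snd t)
    then have r: "r = 2" "u = t" using piv by auto
    \<comment> \<open>After the removal the branch is selected by its size condition instead of by
      \<open>t \<in> B\<close>.\<close>
    then have "card (B - {t}) \<le> d" using u remB[of u] by (auto simp: coord_def)
    then have "pivot m d (A, B - {t}) = Some (2, t)"
      using pivot_snd[of A t "B - {t}"] snd by blast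
    then show ?thesis
      by (intro exI[of _ "(A, B - {u})"])
        (use r u remB[of u] in \<open>auto simp: c lower_at_def coord_def add_vertex_def\<close>)
  next
    case (fst_m t x)
    then have r: "r = 1" "u = m" using piv by auto
    \<comment> \<open>Without \<open>m\<close>, the top gap is \<open>m\<close> itself, and
      \<open>x\<close> still witnesses the branch.\<close>
    have "top_gap (A - {m}) m" by (auto simp: top_gap_def)
    then show ?thesis
      using pivot_fst_m[of "A - {m}" m B x] fst_m r lowerA by auto
  next
    case (fst_gap v)
    then have r: "r = 1" "u = v" using piv by auto
    have "top_gap (A - {v}) m" using fst_gap by (auto simp: top_gap_def)
    then show ?thesis
      using pivot_fst_gap[of "A - {v}" m B v] fst_gap r lowerA by auto
  next
    case none
    then show ?thesis using piv by simp
  qed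
qed

lemma pivot_trichotomy:
  assumes "(A, B) \<in> X" "pivot m d (A, B) = Some (r, u)"
  shows "lower_at r u (A, B) \<or> upper_at r u (A, B) \<or>
    u \<notin> coord r (A, B) \<and> card (coord r (A, B)) = d + 1 \<or> coord r (A, B) = {u}"
proof -
  have "card (coord r (A, B)) \<le> d + 1"
    using assms(1) by (auto simp: DConf_skeleton_iff coord_def)
  then show ?thesis
    using assms by (auto simp: lower_at_def upper_at_def)
qed

text \<open>A pivot in the second coordinate is never stuck: its branch excludes
  \<open>B = {t}\<close> and guarantees room when \<open>t \<notin> B\<close>.\<close>

lemma pivot_snd_lower_or_upper:
  assumes "(A, B) \<in> X" "pivot m d (A, B) = Some (2, u)"
  shows "lower_at 2 u (A, B) \<or> upper_at 2 u (A, B)"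
  using assms(1) by (cases rule: pivot_cases)
    (use pivot_trichotomy[OF assms] assms(2) in \<open>auto simp: coord_def\<close>)

section \<open>The greedy condition for the toggling matching\<close>

text \<open>The top gap \<open>t\<close> of \<open>A\<close> is at least \<open>u\<close>. If
  \<open>t \<in> B\<close>, the larger cell is the upper end for \<open>t > u\<close>; otherwise the
  smaller cell is paired through \<open>t\<close>, which is \<open>u\<close> or comes
  earlier.\<close>

lemma greedy_snd:
  assumes c: "(A, B) \<in> X" and u: "u \<le> m" "u \<notin> A" "u \<notin> B" and c': "(A, insert u B) \<in> X"
  shows "lower_at 2 u (A, B) \<or> (\<exists>u'. u < u' \<and> (lower_at 2 u' (A, B) \<or> upper_at 2 u' (A, insert u B)))"
proof -
  have B: "card B \<le> d" "B \<noteq> {}" using c c' u finite_cell[OF c] by (auto simp: DConf_skeleton_iff)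
  obtain t where t: "top_gap A t" "u \<le> t" using top_gap_exists u by metis
  show ?thesis
  proof (cases "t \<in> B")
    case True
    then have "u < t" using t u by (metis le_neq_implies_less)
    moreover have "pivot m d (A, insert u B) = Some (2, t)"
      using pivot_snd[OF t(1), of "insert u B"] True u by auto
    ultimately show ?thesis
      using c' True u by (auto simp: upper_at_def coord_def)
  next
    case False
    then have "B \<noteq> {t}" by auto
    then have "lower_at 2 t (A, B)"
      using c pivot_snd[OF t(1)] B False by (auto simp: lower_at_def coord_def)
    then show ?thesis using t(2) by (metis le_neq_implies_less)
  qed
qed

text \<open>Compare the pivots of both cells. Either they share a first-coordinate pivot
  \<open>w\<close> with \<open>u \<le> w\<close>, or the larger cell has a second-coordinate pivot,
  or the smaller cell is the lower end of an earlier pairing.\<close>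

lemma greedy_fst:
  assumes c: "(A, B) \<in> X" and u: "u \<le> m" "u \<notin> A" "u \<notin> B" and c': "(insert u A, B) \<in> X"
  shows "lower_at 1 u (A, B) \<or> (\<exists>r u'. lower_at r u' (insert u A, B))
    \<or> (\<exists>r u'. before (r, u') (1, u) \<and> (lower_at r u' (A, B) \<or> upper_at r u' (insert u A, B)))"
proof -
  have A: "card A \<le> d" "A \<noteq> {}" using c c' u finite_cell[OF c] by (auto simp: DConf_skeleton_iff)
  \<comment> \<open>The larger cell is then paired by toggling in the second coordinate: as a lower
    end it is one dimension up, as an upper end it was taken earlier.\<close>
  have snd': ?thesis if "pivot m d (insert u A, B) = Some (2, t)" for t
  proof -
    have "before (2, t) (1, u)" by (simp add: before_def)
    then show ?thesis using pivot_snd_lower_or_upper[OF c' that] by blast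
  qed
  \<comment> \<open>With a shared pivot \<open>w\<close>, the larger cell is an upper end if
    \<open>w \<in> A\<close>, and the smaller cell is a lower end otherwise.\<close>
  have fst': ?thesis if "pivot m d (A, B) = Some (1, w)" "pivot m d (insert u A, B) = Some (1, w)" "u \<le> w"
    for w
  proof (cases "w \<in> A")
    case True
    then have "u < w" using u that(3) by (metis le_neq_implies_less)
    moreover have "upper_at 1 w (insert u A, B)"
      using True u c' that by (auto simp: upper_at_def coord_def)
    ultimately show ?thesis by (auto simp: before_def)
  next
    case False
    then have "lower_at 1 w (A, B)"
      using that c A by (auto simp: lower_at_def coord_def)
    then show ?thesis using that(3) by (auto simp: before_def le_less)
  qed
  \<comment> \<open>Adding \<open>m\<close> fills everything above \<open>Max B\<close>, so the top
    gap drops to \<open>Max B \<in> B\<close> and the pivot moves to the second coordinate.\<close>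
  have snd_if_m: ?thesis
    if "u = m" "\<forall>x. Max B < x \<and> x < m \<longrightarrow> x \<in> A" "card B = d + 1" "Max B < m"
  proof -
    have "finite B" "B \<noteq> {}" using c finite_cell[OF c] by (auto simp: DConf_skeleton_iff)
    then have b: "Max B \<in> B" by simp
    then have "Max B \<notin> insert u A" using c' by (auto simp: DConf_skeleton_iff)
    then have "top_gap (insert u A) (Max B)"
      using that by (auto simp: top_gap_def le_less)
    moreover have "B \<noteq> {Max B}" using that(3) d by (metis Suc_eq_plus1 card_1_singleton_iff
          One_nat_def Suc_inject not_one_le_zero)
    ultimately show ?thesis using snd' pivot_snd b by blast
  qed
  from c show ?thesis
  proof (cases rule: pivot_cases)
    case (singleton t)
    then have "u \<noteq> t" using u by auto
    \<comment> \<open>Vertices above \<open>t\<close> belong to \<open>A\<close>; hence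
      \<open>u\<close> is at most the common pivot \<open>t - 1\<close>.\<close>
    then have ut: "u < t" using singleton u by (meson linorder_neqE_nat top_gap_def)
    then have "top_gap (insert u A) t" using singleton by (auto simp: top_gap_def)
    then show ?thesis
      using fst'[of "t - 1"] pivot_singleton singleton ut by auto
  next
    case (snd t)
    show ?thesis
    proof (cases "t \<in> B")
      case True
      then have "top_gap (insert u A) t" using snd u by (auto simp: top_gap_def)
      then show ?thesis
        using snd' pivot_snd snd True by blast
    next
      case False
      show ?thesis
      proof -
        have "\<not> upper_at 2 t (A, B)" using False by (simp add: upper_at_def coord_def)
        moreover have "before (2, t) (1, u)" by (simp add: before_def)
        ultimately show ?thesis using pivot_snd_lower_or_upper[OF c snd(4)] by blast
      qed
    qed
  next
    case (fst_m t x)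
    show ?thesis
    proof (cases "m \<in> insert u A")
      case True
      obtain t' where t': "top_gap (insert u A) t'" using top_gap_of_cell[OF c'] .
      show ?thesis
      proof (cases "t' \<in> B")
        case True
        moreover have "B \<noteq> {t'}" using fst_m d by auto
        ultimately show ?thesis using snd' pivot_snd t' by blast
      next
        case False
        \<comment> \<open>The new top gap itself serves as the vertex missing strictly between
          \<open>Max B\<close> and \<open>m\<close>.\<close>
        have "t' < m" "t' \<notin> insert u A"
          using t' True by (auto simp: top_gap_def le_less)
        then have "pivot m d (insert u A, B) = Some (1, m)"
          using pivot_fst_m[OF t' False] Max_less_top_gap[OF c' t' False] fst_m by blast
        then show ?thesis using fst' fst_m u by blast
      qed
    next
      case False
      then have "lower_at 1 m (A, B)" "u < m"
        using c A fst_m u by (auto simp: lower_at_def coord_def le_less)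
      then show ?thesis by (auto simp: before_def)
    qed
  next
    case (fst_gap v)
    show ?thesis
    proof (cases "u = m")
      case True
      then show ?thesis using snd_if_m fst_gap by blast
    next
      case False
      then have "u < m" using u by simp
      \<comment> \<open>Vertices strictly between \<open>Max B\<close> and \<open>m\<close> are in
        \<open>A\<close>, those in \<open>{v + 1..Max B}\<close> are in \<open>B\<close>, so
        \<open>u\<close> is at most \<open>v\<close>.\<close>
      then have "u \<le> Max B" using fst_gap u by (meson not_le)
      then have "u \<le> v" using fst_gap u by (meson not_le)
      moreover have "top_gap (insert u A) m" using fst_gap \<open>u < m\<close> by (auto simp: top_gap_def)
      then have "pivot m d (insert u A, B) = Some (1, v)"
        using pivot_fst_gap fst_gap by auto
      ultimately show ?thesis using fst' fst_gap by blast
    qed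
  next
    case none
    \<comment> \<open>Together \<open>A\<close> and \<open>B\<close> contain every vertex below
      \<open>m\<close>, so only \<open>u = m\<close> remains.\<close>
    have "u \<notin> {0..Max B}" using u none by metis
    then have "u = m" using none u by (meson atLeastAtMost_iff le0 le_neq_implies_less not_le)
    then show ?thesis using snd_if_m none by blast
  qed
qed

section \<open>Critical cells as cells that cannot be toggled\<close>

text \<open>A cell has at most one pivot, which gives the uniqueness conditions of
  \<open>greedy_matching\<close>; the upper ends are exactly the \<open>upper_at\<close>
  cells.\<close>

lemma critical_iff:
  assumes "c \<in> X"
  shows "is_critical X (gradient_field m d) c \<longleftrightarrow> \<not> (\<exists>r u. lower_at r u c \<or> upper_at r u c)"
proof -
  interpret greedy_matching m X lower_at
  proof
    have "X \<subseteq> Pow {0..m} \<times> Pow {0..m}" 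
    proof (rule subrelI)
      fix A B assume "(A, B) \<in> X"
      then show "(A, B) \<in> Pow {0..m} \<times> Pow {0..m}" unfolding DConf_skeleton_iff by blast
    qed
    then show "finite X" by (rule finite_subset) auto
    show "A \<noteq> {} \<and> B \<noteq> {} \<and> finite A \<and> finite B" if "(A, B) \<in> X" for A B
      using finite_cell[OF that] that by (auto simp: DConf_skeleton_iff)
    show "c \<in> X \<and> r \<in> {1, 2} \<and> u \<le> m \<and> add_vertex_defined X r u c" if "lower_at r u c" for r u c
      using lower_at_D[OF that] that
      unfolding lower_at_def upper_at_def add_vertex_defined_def by blast
    show "(r', u') = (r, u)" if "lower_at r u c" "lower_at r' u' c" for r u r' u' c
      using that unfolding lower_at_def by simp
    show "\<not> lower_at r' u' (add_vertex r u c)" if "lower_at r u c" for r u r' u' c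
      using lower_at_D[OF that] unfolding lower_at_def upper_at_def by auto
    show "(r', u') = (r, u)"
      if "lower_at r u c" "lower_at r' u' c'" "add_vertex r' u' c' = add_vertex r u c" for r u r' u' c c'
      using lower_at_D[OF that(1)] lower_at_D[OF that(2)] that(3) unfolding upper_at_def by auto
    fix r u c
    assume r: "r \<in> {1, 2 :: nat}" and u: "u \<le> m" and c: "c \<in> X" "add_vertex_defined X r u c"
    obtain A B where AB: "c = (A, B)" by fastforce
    have u': "u \<notin> A" "u \<notin> B" "add_vertex r u c \<in> X"
      using c(2) by (auto simp: AB add_vertex_defined_def)
    consider "lower_at r u c" | r' u' where "lower_at r' u' (add_vertex r u c)"
      | r' u' where "before (r', u') (r, u)" "lower_at r' u' c \<or> upper_at r' u' (add_vertex r u c)"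
    proof (cases "r = 1")
      case True
      then show ?thesis
        using greedy_fst[of A B u] c(1) u u' that by (auto simp: AB add_vertex_def)
    next
      case False
      then show ?thesis
        using greedy_snd[of A B u] c(1) u u' r that by (auto simp: AB add_vertex_def before_def)
    qed
    \<comment> \<open>An earlier upper end supplies its lower end \<open>c'\<close> through
      \<open>upper_at_D\<close>.\<close>
    then show "lower_at r u c \<or> (\<exists>r' u'. lower_at r' u' (add_vertex r u c)) \<or>
        (\<exists>r' u' c'. before (r', u') (r, u) \<and> lower_at r' u' c' \<and>
           (c' = c \<or> add_vertex r' u' c' = add_vertex r u c))"
      by cases (use upper_at_D in blast)+
  qed
  have "is_critical X (gradient_field m d) c \<longleftrightarrow>
      (\<forall>r u c'. lower_at r u c' \<longrightarrow> c \<noteq> c' \<and> c \<noteq> add_vertex r u c')"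
    unfolding is_critical_def gradient_field_def gradient_field_on_eq using assms by blast
  then show ?thesis
    using lower_at_D upper_at_D by metis
qed

section \<open>Classification of the critical cells\<close>

lemma unpaired_iff:
  assumes "(A, B) \<in> X"
  shows "\<not> (\<exists>r u. lower_at r u (A, B) \<or> upper_at r u (A, B)) \<longleftrightarrow>
    (\<forall>r u. pivot m d (A, B) = Some (r, u) \<longrightarrow>
       u \<notin> coord r (A, B) \<and> card (coord r (A, B)) = d + 1 \<or> coord r (A, B) = {u})"
proof -
  have "lower_at r u (A, B) \<or> upper_at r u (A, B) \<longleftrightarrow> pivot m d (A, B) = Some (r, u) \<and>
      \<not> (u \<notin> coord r (A, B) \<and> card (coord r (A, B)) = d + 1 \<or> coord r (A, B) = {u})" for r u
    using pivot_trichotomy[OF assms, of r u] by (auto simp: lower_at_def upper_at_def)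
  then show ?thesis by blast
qed

text \<open>A stuck pivot has a full coordinate or is alone in it. Branch \<open>singleton\<close>
  yields types 2 and 1, \<open>fst_m\<close> types 5 and 3, \<open>fst_gap\<close> types 6 and 4,
  and \<open>none\<close> type 7; \<open>snd\<close> cannot be stuck.\<close>

lemma unpaired_critical_type:
  assumes c: "(A, B) \<in> X"
    and up: "\<And>r u. pivot m d (A, B) = Some (r, u) \<Longrightarrow>
       u \<notin> coord r (A, B) \<and> card (coord r (A, B)) = d + 1 \<or> coord r (A, B) = {u}"
  shows "\<exists>i \<in> {1..7}. critical_type m d i A B"
proof -
  have cell: "A \<noteq> {}" "B \<noteq> {}" "A \<subseteq> {0..m}" "B \<subseteq> {0..m}" "A \<inter> B = {}"
    "card A \<le> d + 1" "card B \<le> d + 1" and fin: "finite A" "finite B"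
    using c finite_cell[OF c] by (simp_all add: DConf_skeleton_iff)
  have card_Un: "card A + card B \<le> card C" if "A \<union> B \<subseteq> C" "finite C" for C
    using card_mono[OF that(2,1)] card_Un_disjoint[OF fin cell(5)] by simp
  have Max_less: "Max S < m" if "finite S" "S \<noteq> {}" "S \<subseteq> {0..m}" "m \<notin> S" for S
    using that by (metis Max_in atLeastAtMost_iff in_mono le_neq_implies_less)
  from c show ?thesis
  proof (cases rule: pivot_cases)
    case (singleton t)
    then consider "t - 1 \<notin> A" "card A = d + 1" | "A = {t - 1}"
      using up[OF singleton(4)] by (auto simp: coord_def)
    then show ?thesis
    proof cases
      case 1
      have "{t + 1..m} \<subseteq> A" using singleton(1) by (auto simp: top_gap_def)
      then have "critical_type m d 2 A B"
        using 1 singleton unfolding critical_type_def by simp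
      then show ?thesis by (intro bexI[of _ 2]) auto
    next
      case 2
      \<comment> \<open>If \<open>t < m\<close>, then \<open>m\<close> would lie in
        \<open>A = {t - 1}\<close>.\<close>
      have "t = m"
      proof (rule ccontr)
        assume "t \<noteq> m"
        then have "m \<in> A" using singleton(1) by (auto simp: top_gap_def)
        then have "m = t - 1" using 2 by simp
        moreover have "t \<le> m" using singleton(1) by (simp add: top_gap_def)
        ultimately show False using singleton(3) by simp
      qed
      then have "critical_type m d 1 A B"
        using 2 singleton(2) unfolding critical_type_def by simp
      then show ?thesis by (intro bexI[of _ 1]) auto
    qed
  next
    case (snd t)
    then show ?thesis using up[OF snd(4)] by (auto simp: coord_def)
  next
    case (fst_m t x)
    then consider "m \<notin> A" "card A = d + 1" | "A = {m}"
      using up[OF fst_m(9)] by (auto simp: coord_def)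
    then show ?thesis
    proof cases
      case 1
      \<comment> \<open>Two disjoint sets of \<open>d + 1\<close> vertices avoid \<open>m\<close>,
        which gives the numerical bound.\<close>
      have "A \<union> B \<subseteq> {0..<m}"
      proof
        fix y assume y: "y \<in> A \<union> B"
        then have "y \<le> m" using cell by auto
        moreover have "y \<noteq> m" using y 1 fst_m(8) by auto
        ultimately show "y \<in> {0..<m}" by simp
      qed
      then have "2 * (d + 1) \<le> m"
        using card_Un[of "{0..<m}"] 1 fst_m by simp
      moreover have "x \<in> {1 + Max B..m - 1}" using fst_m by auto
      then have "\<not> {1 + Max B..m - 1} \<subseteq> A" using fst_m(7) by blast
      moreover have "Max A < m" using Max_less[of A] cell fin 1 by simp
      ultimately have "critical_type m d 5 A B"
        using 1 fst_m unfolding critical_type_def by simp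
      then show ?thesis by (intro bexI[of _ 5]) auto
    next
      case 2
      then have "critical_type m d 3 A B"
        using fst_m unfolding critical_type_def by simp
      then show ?thesis by (intro bexI[of _ 3]) auto
    qed
  next
    case (fst_gap v)
    have mA: "m \<notin> A" using fst_gap(1) by (simp add: top_gap_def)
    consider "v \<notin> A" "card A = d + 1" | "A = {v}"
      using up[OF fst_gap(9)] by (auto simp: coord_def)
    then show ?thesis
    proof cases
      case 1
      \<comment> \<open>Both sets also avoid \<open>v\<close>, so the bound becomes strict.\<close>
      have "A \<union> B \<subseteq> {0..<m} - {v}"
      proof
        fix x assume x: "x \<in> A \<union> B"
        then have "x \<le> m" using cell by auto
        moreover have "x \<noteq> m" "x \<noteq> v" using x mA fst_gap 1 by auto
        ultimately show "x \<in> {0..<m} - {v}" by simp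
      qed
      moreover have "v < m" using fst_gap by simp
      ultimately have "2 * (d + 1) < m"
        using card_Un[of "{0..<m} - {v}"] 1 fst_gap(3) by simp
      moreover have "Max (A \<union> B) < m"
        using Max_less[of "A \<union> B"] cell fin mA fst_gap(2) by simp
      moreover have "{1 + Max B..m - 1} \<subseteq> A" using fst_gap(5) by auto
      moreover have "{0..Max B} \<noteq> B" using fst_gap(6,7) by (metis atLeastAtMost_iff le0 less_imp_le)
      moreover have "Max ({0..Max B} - B) = v"
        using Max_Diff_interval_eq[OF _ fst_gap(7,8)] fst_gap(6) by simp
      ultimately have "critical_type m d 6 A B"
        using 1 fst_gap(3) unfolding critical_type_def by simp
      then show ?thesis by (intro bexI[of _ 6]) auto
    next
      case 2
      \<comment> \<open>The only vertex of \<open>A\<close> is \<open>v < Max B\<close>, so no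
        vertex may lie strictly between \<open>Max B\<close> and \<open>m\<close>.\<close>
      have "m - 1 \<in> A" if "Max B < m - 1" using fst_gap(5) that by simp
      then have b: "Max B = m - 1" using 2 fst_gap(4,6) by fastforce
      moreover have "{0..m - 1} \<noteq> B" using fst_gap(6,7) b by (metis atLeastAtMost_iff le0 less_imp_le)
      moreover have "Max ({0..m - 1} - B) = v"
        using Max_Diff_interval_eq[OF _ fst_gap(7,8)] fst_gap(6) b by simp
      ultimately have "critical_type m d 4 A B"
        using 2 fst_gap(3) unfolding critical_type_def by simp
      then show ?thesis by (intro bexI[of _ 4]) auto
    qed
  next
    case none
    have mA: "m \<notin> A" using none(1) by (simp add: top_gap_def)
    have "card B = Max B + 1" using none(6) by (metis card_atLeastAtMost diff_zero Suc_eq_plus1)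
    then have b: "Max B = d" using none(3) by simp
    then have B: "B = {0..d}" using none(6) by simp
    have "A = {d + 1..m - 1}"
    proof
      show "{d + 1..m - 1} \<subseteq> A" using none(5) b by auto
      show "A \<subseteq> {d + 1..m - 1}"
      proof
        fix x assume x: "x \<in> A"
        then have "x \<notin> B" using cell by auto
        moreover have "x \<noteq> m" "x \<le> m" using x mA cell by auto
        ultimately show "x \<in> {d + 1..m - 1}" using B by simp
      qed
    qed
    \<comment> \<open>Here \<open>card A = m - 1 - d\<close>, and \<open>card A \<le> d + 1\<close>
      becomes the bound on \<open>m\<close>.\<close>
    then have "critical_type m d 7 A B"
      using B cell(6) unfolding critical_type_def by auto
    then show ?thesis by (intro bexI[of _ 7]) auto
  qed
qed

text \<open>Each type determines its branch of \<open>pivot\<close>; the remaining conditions of the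
  type make that pivot stuck, and type 7 has none.\<close>

lemma critical_type_unpaired:
  assumes c: "(A, B) \<in> X" and type: "critical_type m d i A B"
    and piv: "pivot m d (A, B) = Some (r, u)"
  shows "u \<notin> coord r (A, B) \<and> card (coord r (A, B)) = d + 1 \<or> coord r (A, B) = {u}"
proof -
  have cell: "A \<noteq> {}" "B \<noteq> {}" "A \<subseteq> {0..m}" "B \<subseteq> {0..m}" "A \<inter> B = {}" and fin: "finite A" "finite B"
    using c finite_cell[OF c] by (simp_all add: DConf_skeleton_iff)
  have in_B: "x \<notin> B" if "Max B < x" for x
    using that fin by (meson Max_ge leD)
  have in_A: "x \<notin> A" if "Max A < x" for x
    using that fin by (meson Max_ge leD)
  have stuck: ?thesis
    if "pivot m d (A, B) = Some (1, w)" "w \<notin> A \<and> card A = d + 1 \<or> A = {w}" for w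
    using that piv by (auto simp: coord_def)
  from type show ?thesis
    unfolding critical_type_def
  proof (elim disjE conjE exE)
    assume *: "A = {m - 1}" "B = {m}"
    then have "top_gap A m" using m by (auto simp: top_gap_def)
    then show ?thesis using * pivot_singleton stuck by blast
  next
    fix b assume *: "B = {b}" "1 \<le> b" "b - 1 \<notin> A" "{b + 1..m} \<subseteq> A" "card A = d + 1"
    then have "b \<le> m" "b \<notin> A" using cell by auto
    then have "top_gap A b" using *(4) by (simp add: top_gap_def subset_iff)
    then show ?thesis using * pivot_singleton stuck by blast
  next
    assume *: "A = {m}" "Max B < m - 1" "card B = d + 1"
    \<comment> \<open>The vertex \<open>m - 1\<close> is both the top gap of \<open>{m}\<close> and
      the missing vertex above \<open>Max B\<close>.\<close>
    have "x = m" if "m - 1 < x" "x \<le> m" for x using that by linarith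
    then have "top_gap A (m - 1)" using m by (simp add: *(1) top_gap_def)
    then have "pivot m d (A, B) = Some (1, m)"
      using pivot_fst_m[of A "m - 1" B "m - 1"] * in_B m by simp
    then show ?thesis using * stuck by blast
  next
    assume *: "Max B = m - 1" "{0..m - 1} \<noteq> B" "A = {Max ({0..m - 1} - B)}" "card B = d + 1"
    define v where "v = Max ({0..m - 1} - B)"
    have "B \<subseteq> {0..m - 1}" using fin *(1) by (metis Max_ge atLeastAtMost_iff le0 subsetI)
    then have "{0..m - 1} - B \<noteq> {}" using *(2) by blast
    note v = Max_Diff_interval[OF this v_def]
    have "m - 1 \<in> B" using *(1) Max_in[OF fin(2) cell(2)] by simp
    then have "v < m - 1" using v by (metis le_neq_implies_less)
    moreover have A: "A = {v}" using * v_def by simp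
    ultimately have "top_gap A m" by (auto simp: top_gap_def)
    moreover have "m \<notin> B" using in_B *(1) m by simp
    moreover have "\<forall>x. Max B < x \<and> x < m \<longrightarrow> x \<in> A" using *(1) by auto
    moreover have "v < Max B" "\<forall>x. v < x \<and> x \<le> Max B \<longrightarrow> x \<in> B"
      using \<open>v < m - 1\<close> v(3) *(1) by simp_all
    ultimately have "pivot m d (A, B) = Some (1, v)"
      using pivot_fst_gap[of A m B v] *(4) v(2) by blast
    then show ?thesis using A stuck by blast
  next
    assume *: "Max A < m" "\<not> {1 + Max B..m - 1} \<subseteq> A" "card A = d + 1" "card B = d + 1"
    obtain x where x: "x \<in> {1 + Max B..m - 1}" "x \<notin> A" using *(2) by blast
    then have x': "Max B < x" "x < m" using m by auto
    moreover have mA: "m \<notin> A" using in_A *(1) by simp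
    then have "top_gap A m" by (simp add: top_gap_m)
    moreover have "m \<notin> B" using in_B x' by simp
    ultimately have "pivot m d (A, B) = Some (1, m)"
      using pivot_fst_m * x by blast
    then show ?thesis using *(3) mA stuck by blast
  next
    assume *: "Max (A \<union> B) < m" "{1 + Max B..m - 1} \<subseteq> A" "{0..Max B} \<noteq> B"
      "Max ({0..Max B} - B) \<notin> A" "card A = d + 1" "card B = d + 1"
    have mAB: "m \<notin> A \<union> B" using *(1) fin by (meson Max_ge finite_UnI leD)
    define v where "v = Max ({0..Max B} - B)"
    have "B \<subseteq> {0..Max B}" using fin by (simp add: subset_iff)
    then have "{0..Max B} - B \<noteq> {}" using *(3) by blast
    note v = Max_Diff_interval[OF this v_def]
    have "v < Max B" using v Max_in[OF fin(2) cell(2)] by (metis le_neq_implies_less)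
    moreover have "top_gap A m" using mAB by (simp add: top_gap_m)
    moreover have "\<forall>x. Max B < x \<and> x < m \<longrightarrow> x \<in> A" using *(2) by auto
    ultimately have "pivot m d (A, B) = Some (1, v)"
      using pivot_fst_gap[of A m B v] * v mAB by blast
    then show ?thesis using *(4,5) stuck unfolding v_def by blast
  next
    assume *: "A = {d + 1..m - 1}" "B = {0..d}"
    have "top_gap A m" using *(1) m by (auto simp: top_gap_m)
    moreover have "Max B = d" unfolding *(2) by (rule Max_eqI) auto
    moreover have "m \<notin> B" using *(2) m by simp
    moreover have "card B = d + 1" using *(2) by simp
    ultimately have "pivot m d (A, B) = None"
      using * by (auto simp: pivot_def top_gap_Max Let_def)
    then show ?thesis using piv by simp
  qed
qed

section \<open>Mutual exclusion and dimensions\<close>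

text \<open>Recovering the type as a function of the cell makes the types mutually
  exclusive.\<close>

definition type_index :: "nat set \<Rightarrow> nat set \<Rightarrow> nat" where
  "type_index A B =
     (if card B = 1 then if card A = 1 then 1 else 2
      else if m \<in> A then 3
      else if \<not> {1 + Max B..m - 1} \<subseteq> A then 5
      else if B = {0..Max B} then 7
      else if card A = 1 then 4 else 6)"

text \<open>Since \<open>1 \<le> d\<close>, a full coordinate is never a singleton, so the
  cardinality tests in \<open>type_index\<close> tell the two apart.\<close>

lemma critical_type_index:
  assumes c: "(A, B) \<in> X" and type: "critical_type m d i A B"
  shows "i = type_index A B" and "cell_dim (A, B) = critical_type_dim m d i"
proof -
  have cell: "A \<noteq> {}" "B \<noteq> {}" and fin: "finite A" "finite B"
    using c finite_cell[OF c] by (simp_all add: DConf_skeleton_iff)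
  have "i = type_index A B \<and> cell_dim (A, B) = critical_type_dim m d i"
    using type unfolding critical_type_def
  proof (elim disjE conjE exE)
    assume "i = 1" "A = {m - 1}" "B = {m}"
    then show ?thesis
      by (simp add: type_index_def cell_dim_def simplex_dim_def critical_type_dim_def)
  next
    fix b assume "i = 2" "B = {b}" "card A = d + 1"
    then show ?thesis
      using d by (simp add: type_index_def cell_dim_def simplex_dim_def critical_type_dim_def)
  next
    assume "i = 3" "A = {m}" "card B = d + 1"
    then show ?thesis
      using d by (simp add: type_index_def cell_dim_def simplex_dim_def critical_type_dim_def)
  next
    assume *: "i = 4" "Max B = m - 1" "{0..m - 1} \<noteq> B" "A = {Max ({0..m - 1} - B)}" "card B = d + 1"
    have "B \<subseteq> {0..m - 1}" using fin *(2) by (metis Max_ge atLeastAtMost_iff le0 subsetI)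
    then have "{0..m - 1} - B \<noteq> {}" using *(3) by blast
    from Max_Diff_interval(1)[OF this refl] have "m \<notin> A"
      using *(4) m by auto
    moreover have "card A = 1" using *(4) by simp
    moreover have "{1 + Max B..m - 1} = {}" using *(2) by simp
    moreover have "B \<noteq> {0..Max B}" using *(2,3) by simp
    ultimately show ?thesis
      using d * by (simp add: type_index_def cell_dim_def simplex_dim_def critical_type_dim_def)
  next
    assume *: "i = 5" "Max A < m" "\<not> {1 + Max B..m - 1} \<subseteq> A" "card A = d + 1" "card B = d + 1"
    have "m \<notin> A" using *(2) fin by (meson Max_ge leD)
    then show ?thesis
      using d * by (simp add: type_index_def cell_dim_def simplex_dim_def critical_type_dim_def)
  next
    assume *: "i = 6" "Max (A \<union> B) < m" "{1 + Max B..m - 1} \<subseteq> A" "{0..Max B} \<noteq> B"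
      "card A = d + 1" "card B = d + 1"
    have "m \<notin> A" using *(2) fin by (meson Max_ge UnI1 finite_UnI leD)
    moreover have "B \<noteq> {0..Max B}" using *(4) by simp
    ultimately show ?thesis
      using d *(1,3,5,6) by (simp add: type_index_def cell_dim_def simplex_dim_def critical_type_dim_def)
  next
    assume *: "i = 7" "A = {d + 1..m - 1}" "B = {0..d}"
    have "Max B = d" unfolding *(3) by (rule Max_eqI) auto
    moreover have "m \<notin> A" using *(2) m by auto
    \<comment> \<open>The bound \<open>d + 2 \<le> m\<close> makes \<open>A\<close> nonempty, so no
      subtraction truncates and the dimension is \<open>(m - 2 - d) + d\<close>.\<close>
    ultimately show ?thesis
      using d m * by (simp add: type_index_def cell_dim_def simplex_dim_def critical_type_dim_def)
  qed
  then show "i = type_index A B" "cell_dim (A, B) = critical_type_dim m d i" by auto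
qed

end

theorem theorem1p6:
  fixes m d :: nat
  assumes "1 \<le> d" and "d + 2 \<le> m"
  shows "DConf_skeleton m d =
           {(A, B). A \<noteq> {} \<and> B \<noteq> {} \<and> A \<subseteq> {0..m} \<and> B \<subseteq> {0..m} \<and> A \<inter> B = {}
              \<and> card A \<le> d + 1 \<and> card B \<le> d + 1}
    \<and> (\<forall>(A, B) \<in> DConf_skeleton m d.
         (is_critical (DConf_skeleton m d) (gradient_field m d) (A, B)
            \<longleftrightarrow> (\<exists>i \<in> {1..7}. critical_type m d i A B))
       \<and> (\<forall>i \<in> {1..7}. \<forall>j \<in> {1..7}.
            critical_type m d i A B \<and> critical_type m d j A B \<longrightarrow> i = j)
       \<and> (\<forall>i \<in> {1..7}. critical_type m d i A B
            \<longrightarrow> cell_dim (A, B) = critical_type_dim m d i))"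
proof (intro conjI ballI)
  interpret dconf m d
    using assms by unfold_locales
  show "X = {(A, B). A \<noteq> {} \<and> B \<noteq> {} \<and> A \<subseteq> {0..m} \<and> B \<subseteq> {0..m} \<and> A \<inter> B = {}
      \<and> card A \<le> d + 1 \<and> card B \<le> d + 1}"
    by (intro set_eqI) (simp only: split_paired_all mem_Collect_eq prod.case DConf_skeleton_iff)
  fix c assume c: "c \<in> X"
  obtain A B where AB: "c = (A, B)" by fastforce
  have "is_critical X (gradient_field m d) (A, B) \<longleftrightarrow> (\<exists>i \<in> {1..7}. critical_type m d i A B)"
    using critical_iff unpaired_iff unpaired_critical_type critical_type_unpaired c unfolding AB
    by metis
  moreover have "i = j" if "critical_type m d i A B" "critical_type m d j A B" for i j
    using critical_type_index(1) c that unfolding AB by metis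
  moreover have "cell_dim (A, B) = critical_type_dim m d i" if "critical_type m d i A B" for i
    using critical_type_index(2) c that unfolding AB by blast
  ultimately show "case c of (A, B) \<Rightarrow>
      (is_critical X (gradient_field m d) (A, B) \<longleftrightarrow> (\<exists>i \<in> {1..7}. critical_type m d i A B))
    \<and> (\<forall>i \<in> {1..7}. \<forall>j \<in> {1..7}. critical_type m d i A B \<and> critical_type m d j A B \<longrightarrow> i = j)
    \<and> (\<forall>i \<in> {1..7}. critical_type m d i A B \<longrightarrow> cell_dim (A, B) = critical_type_dim m d i)"
    unfolding AB by blast
qed

end
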